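(* Let $R$ be an associative ring with unit element $1\neq 0$. Then the radical parallelism $\parallel$ on the projective line $\mathbb{P}(R)$ is an equivalence relation.
   Context: All rings are associative with unit element $1\neq 0$. $\mathrm{GL}_2(R)$ is the group of invertible $2\times 2$-matrices over $R$, acting from the right on row vectors in the free left $R$-module $R^2$. A pair $(a,b)\in R^2$ is admissible if it is the first row of some matrix in $\mathrm{GL}_2(R)$. The projective line over $R$ is $\mathbb{P}(R):=\{R(a,b)\mid (a,b)\in R^2 \text{ admissible}\}$, i.e. the orbit of the cyclic submodule $R(1,0)$ of $R^2$ under $\mathrm{GL}_2(R)$; points are always represented by admissible pairs. Two points $p=R(a,b)$, $q=R(c,d)$ (with $(a,b),(c,d)$ admissible) are called distant, written $p\mathrel{\triangle} q$, if $\begin{pmatrix}a&b\\c&d\end{pmatrix}\in\mathrm{GL}_2(R)$; equivalently, $\triangle$ is the orbit of the pair $(R(1,0),R(0,1))$ under $\mathrm{GL}_2(R)$. A point $p\in\mathbb{P}(R)$ is called radically parallel to a point $q\in\mathbb{P}(R)$, written $p\parallel q$, if for all $x\in\mathbb{P}(R)$: $x\mathrel{\triangle} p$ implies $x\mathrel{\triangle} q$. The relation $\parallel$ is called the radical parallelism on $\mathbb{P}(R)$. *)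

theory Defs
  imports "HOL-Analysis.Analysis"
begin

text \<open>
  The ring is the type \<open>'a :: ring_1\<close>: associative, with a unit element \<open>1 \<noteq> 0\<close>, not
  assumed commutative. Scalars act from the left on row vectors by \<open>*s\<close>, and
  \<open>GL\<^sub>2(R)\<close> is the set of matrices \<open>A :: 'a^2^2\<close> with \<open>invertible A\<close> (two-sided inverse).
\<close>

definition admissible :: "'a::ring_1 ^ 2 \<Rightarrow> bool" where
  "admissible v \<longleftrightarrow> (\<exists>A :: 'a ^ 2 ^ 2. invertible A \<and> row 1 A = v)"

definition cyclic_submodule :: "'a::ring_1 ^ 2 \<Rightarrow> ('a ^ 2) set" where
  "cyclic_submodule v = {r *s v | r. True}"

definition projective_line :: "('a::ring_1 ^ 2) set set" where
  "projective_line = {cyclic_submodule v | v. admissible v}"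

text \<open>
  The choice of the admissible representatives does not matter, see
  \<open>distant_cyclic_submodule_iff\<close> below.
\<close>

definition distant :: "('a::ring_1 ^ 2) set \<Rightarrow> ('a ^ 2) set \<Rightarrow> bool" where
  "distant p q \<longleftrightarrow> (\<exists>v w. admissible v \<and> admissible w \<and>
     p = cyclic_submodule v \<and> q = cyclic_submodule w \<and>
     invertible (vector [v, w] :: 'a ^ 2 ^ 2))"

definition radical_parallelism :: "(('a::ring_1 ^ 2) set \<times> ('a ^ 2) set) set" where
  "radical_parallelism = {(p, q). p \<in> projective_line \<and> q \<in> projective_line \<and>
     (\<forall>x\<in>projective_line. distant x p \<longrightarrow> distant x q)}"

lemma admissible_smult_eq_self:
  fixes v :: "'a::ring_1 ^ 2"
  assumes "admissible v" and "a *s v = v"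
  shows "a = 1"
proof -
  obtain A B :: "'a ^ 2 ^ 2" where A: "A ** B = mat 1" "A $ 1 = v"
    using assms(1) by (auto simp: admissible_def invertible_def row_def vec_eq_iff)
  have 1: "v $ 1 * B $ 1 $ 1 + v $ 2 * B $ 2 $ 1 = 1"
    using arg_cong[OF A(1), of "\<lambda>M. M $ 1 $ 1"] A(2)
    by (simp add: matrix_matrix_mult_def mat_def sum_2)
  have v: "a * v $ 1 = v $ 1" "a * v $ 2 = v $ 2"
    using assms(2) by (metis vector_smult_component)+
  have "a = a * (v $ 1 * B $ 1 $ 1 + v $ 2 * B $ 2 $ 1)"
    by (simp add: 1)
  also have "\<dots> = (a * v $ 1) * B $ 1 $ 1 + (a * v $ 2) * B $ 2 $ 1"
    by (simp only: distrib_left mult.assoc)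
  also have "\<dots> = 1"
    by (simp only: v 1)
  finally show ?thesis .
qed

lemma cyclic_submodule_eqD:
  fixes v w :: "'a::ring_1 ^ 2"
  assumes "admissible v" "admissible w" "cyclic_submodule v = cyclic_submodule w"
  obtains a b where "a * b = 1" "b * a = 1" "v = a *s w"
proof -
  have self: "u \<in> cyclic_submodule u" for u :: "'a ^ 2"
    unfolding cyclic_submodule_def by (auto intro!: exI[of _ 1])
  have "v \<in> cyclic_submodule w" "w \<in> cyclic_submodule v"
    using self[of v] self[of w] assms(3) by simp_all
  then obtain a b where ab: "v = a *s w" "w = b *s v"
    unfolding cyclic_submodule_def by blast
  have "(a * b) *s v = v" "(b * a) *s w = w"
    using ab by (metis vector_smult_assoc)+
  then have "a * b = 1" "b * a = 1"
    using admissible_smult_eq_self assms by blast+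
  then show ?thesis
    using that ab(1) by blast
qed

lemma distant_cyclic_submodule_iff:
  fixes v w :: "'a::ring_1 ^ 2"
  assumes "admissible v" "admissible w"
  shows "distant (cyclic_submodule v) (cyclic_submodule w) \<longleftrightarrow>
    invertible (vector [v, w] :: 'a ^ 2 ^ 2)"
proof
  assume "distant (cyclic_submodule v) (cyclic_submodule w)"
  then obtain v' w' where vw: "admissible v'" "admissible w'"
    "cyclic_submodule v = cyclic_submodule v'" "cyclic_submodule w = cyclic_submodule w'"
    and inv: "invertible (vector [v', w'] :: 'a ^ 2 ^ 2)"
    unfolding distant_def by blast
  obtain a b where ab: "a * b = 1" "b * a = 1" "v = a *s v'"
    using cyclic_submodule_eqD assms(1) vw by metis
  obtain c d where cd: "c * d = 1" "d * c = 1" "w = c *s w'"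
    using cyclic_submodule_eqD assms(2) vw by metis
  define D where "D = (vector [vector [a, 0], vector [0, c]] :: 'a ^ 2 ^ 2)"
  define E where "E = (vector [vector [b, 0], vector [0, d]] :: 'a ^ 2 ^ 2)"
  have DE: "D ** E = mat 1" "E ** D = mat 1"
    unfolding D_def E_def using ab cd
    by (simp_all add: vec_eq_iff forall_2 matrix_matrix_mult_def mat_def sum_2)
  have eq: "(vector [v, w] :: 'a ^ 2 ^ 2) = D ** vector [v', w']"
    unfolding D_def using ab cd
    by (simp add: vec_eq_iff forall_2 matrix_matrix_mult_def sum_2)
  obtain M where M: "vector [v', w'] ** M = (mat 1 :: 'a ^ 2 ^ 2)"
    "M ** vector [v', w'] = (mat 1 :: 'a ^ 2 ^ 2)"
    using inv unfolding invertible_def by blast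
  have "vector [v, w] ** (M ** E) = (mat 1 :: 'a ^ 2 ^ 2)"
    unfolding eq by (metis DE(1) M(1) matrix_mul_assoc matrix_mul_rid)
  moreover have "(M ** E) ** vector [v, w] = (mat 1 :: 'a ^ 2 ^ 2)"
    unfolding eq by (metis DE(2) M(2) matrix_mul_assoc matrix_mul_rid)
  ultimately show "invertible (vector [v, w] :: 'a ^ 2 ^ 2)"
    unfolding invertible_def by blast
qed (use assms in \<open>auto simp: distant_def\<close>)

end

theory Submission
  imports Defs
begin

text \<open>
  Only symmetry is not immediate. In a basis whose first vector spans \<open>p\<close>, the points distant
  from \<open>p = R(1,0)\<close> are the \<open>R(x,1)\<close>, and \<open>R(a,b)\<close> is distant from all of them iff \<open>a - b x\<close> is
  a unit for every \<open>x\<close>. Hence \<open>q = R(1,j)\<close> with \<open>1 - j x\<close> a unit for all \<open>x\<close>. As \<open>1 - j x\<close> is a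
  unit iff \<open>1 - x j\<close> is, a point \<open>R(c,d)\<close> with \<open>d - c j\<close> a unit also has \<open>d\<close> a unit, that is,
  every point distant from \<open>q\<close> is distant from \<open>p\<close>.
\<close>

text \<open>In a noncommutative ring a one-sided inverse need not be two-sided, so both equations
  are demanded, as in \<open>invertible\<close>.\<close>

definition two_sided_unit :: "'a::ring_1 \<Rightarrow> bool" where
  "two_sided_unit u \<longleftrightarrow> (\<exists>u'. u * u' = 1 \<and> u' * u = 1)"

lemma two_sided_unit_mult:
  assumes "two_sided_unit a" "two_sided_unit b"
  shows "two_sided_unit (a * b)"
proof -
  obtain a' b' where "a * a' = 1" "a' * a = 1" "b * b' = 1" "b' * b = 1"
    using assms unfolding two_sided_unit_def by blast
  then have "(a * b) * (b' * a') = 1" "(b' * a') * (a * b) = 1"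
    by (metis mult.assoc mult_1_right)+
  then show ?thesis
    unfolding two_sided_unit_def by blast
qed

text \<open>Jacobson's lemma: if \<open>u\<close> inverts \<open>1 + a * b\<close>, then
  \<open>1 - b * u * a\<close> inverts \<open>1 + b * a\<close>, as a formal geometric series
  expansion suggests.\<close>

lemma two_sided_unit_one_plus_mult_commute:
  fixes a b :: "'a::ring_1"
  assumes "two_sided_unit (1 + a * b)"
  shows "two_sided_unit (1 + b * a)"
proof -
  obtain u where u: "(1 + a * b) * u = 1" "u * (1 + a * b) = 1"
    using assms unfolding two_sided_unit_def by blast
  have "(1 + b * a) * (1 - b * u * a) = 1 + b * a - b * ((1 + a * b) * u) * a"
    by (simp add: algebra_simps)
  moreover have "(1 - b * u * a) * (1 + b * a) = 1 + b * a - b * (u * (1 + a * b)) * a"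
    by (simp add: algebra_simps)
  ultimately have "(1 + b * a) * (1 - b * u * a) = 1" "(1 - b * u * a) * (1 + b * a) = 1"
    by (simp_all add: u)
  then show ?thesis
    unfolding two_sided_unit_def by blast
qed

lemma invertible_matrix_mult_right_iff:
  fixes A B :: "'a::ring_1 ^ 'n ^ 'n"
  assumes "invertible B"
  shows "invertible (A ** B) \<longleftrightarrow> invertible A"
proof
  assume AB: "invertible (A ** B)"
  obtain B' where B': "B ** B' = mat 1" "B' ** B = mat 1"
    using assms unfolding invertible_def by blast
  then have "invertible B'"
    unfolding invertible_def by blast
  with AB have "invertible (A ** B ** B')"
    by (rule invertible_mult)
  then show "invertible A"
    by (metis B'(1) matrix_mul_assoc matrix_mul_rid)
qed (simp add: assms invertible_mult)

lemma invertible_matrix_mult_left_iff: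
  fixes A B :: "'a::ring_1 ^ 'n ^ 'n"
  assumes "invertible A"
  shows "invertible (A ** B) \<longleftrightarrow> invertible B"
proof
  assume AB: "invertible (A ** B)"
  obtain A' where A': "A ** A' = mat 1" "A' ** A = mat 1"
    using assms unfolding invertible_def by blast
  then have "invertible A'"
    unfolding invertible_def by blast
  then have "invertible (A' ** (A ** B))"
    using AB by (rule invertible_mult)
  then show "invertible B"
    by (metis A'(2) matrix_mul_assoc matrix_mul_lid)
qed (simp add: assms invertible_mult)

text \<open>Turns coefficients relative to \<open>v\<close>, \<open>w\<close> into a left matrix
  factor, so that coordinates can be handled by factoring matrices.\<close>

lemma matrix_mult_2:
  fixes v w :: "'a::ring_1 ^ 2"
  shows "(vector [vector [a, b], vector [c, d]] :: 'a ^ 2 ^ 2) ** vector [v, w] =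
    (vector [a *s v + b *s w, c *s v + d *s w] :: 'a ^ 2 ^ 2)"
  by (simp add: vec_eq_iff forall_2 matrix_matrix_mult_def sum_2)

lemma smult_vector_2: "a *s (vector [x, y] :: 'a::ring_1 ^ 2) = vector [a * x, a * y]"
  by (simp add: vec_eq_iff forall_2)

lemma add_vector_2: "(vector [x, y] :: 'a::ring_1 ^ 2) + vector [x', y'] = vector [x + x', y + y']"
  by (simp add: vec_eq_iff forall_2)

lemma mat_1_eq_vector: "(mat 1 :: 'a::ring_1 ^ 2 ^ 2) = vector [vector [1, 0], vector [0, 1]]"
  by (simp add: vec_eq_iff forall_2 mat_def)

text \<open>Left multiplication by a permutation matrix exchanges the rows; this makes distance
  symmetric.\<close>

lemma invertible_vector_swap:
  fixes v w :: "'a::ring_1 ^ 2"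
  shows "invertible (vector [v, w] :: 'a ^ 2 ^ 2) \<longleftrightarrow> invertible (vector [w, v] :: 'a ^ 2 ^ 2)"
proof -
  let ?P = "vector [vector [0, 1], vector [1, 0]] :: 'a ^ 2 ^ 2"
  have "?P ** ?P = mat 1"
    by (simp add: matrix_mult_2 mat_1_eq_vector smult_vector_2 add_vector_2)
  then have "invertible ?P"
    unfolding invertible_def by blast
  then have "invertible (?P ** vector [w, v]) \<longleftrightarrow> invertible (vector [w, v] :: 'a ^ 2 ^ 2)"
    by (rule invertible_matrix_mult_left_iff)
  then show ?thesis
    by (simp add: matrix_mult_2)
qed

lemma invertible_upper_unitriangular:
  "invertible (vector [vector [1, x], vector [0, 1]] :: 'a::ring_1 ^ 2 ^ 2)"
  unfolding invertible_def
  by (rule exI[of _ "vector [vector [1, - x], vector [0, 1]]"])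
    (simp add: matrix_mult_2 mat_1_eq_vector smult_vector_2 add_vector_2)

lemma invertible_antidiagonal_iff:
  fixes a s :: "'a::ring_1"
  assumes "two_sided_unit a"
  shows "invertible (vector [vector [0, s], vector [a, 0]] :: 'a ^ 2 ^ 2) \<longleftrightarrow> two_sided_unit s"
    (is "invertible ?A \<longleftrightarrow> _")
proof
  assume "invertible ?A"
  then obtain B where B: "?A ** B = mat 1" "B ** ?A = mat 1"
    unfolding invertible_def by blast
  \<comment> \<open>A single entry of \<open>B\<close> is both a right and a left inverse of
    \<open>s\<close>: it occurs in entry (1,1) of one product and in entry (2,2) of the
    other.\<close>
  have "s * B $ 2 $ 1 = 1" "B $ 2 $ 1 * s = 1"
    using arg_cong[OF B(1), of "\<lambda>M. M $ 1 $ 1"] arg_cong[OF B(2), of "\<lambda>M. M $ 2 $ 2"]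
    by (simp_all add: matrix_matrix_mult_def mat_def sum_2)
  then show "two_sided_unit s"
    unfolding two_sided_unit_def by blast
next
  assume "two_sided_unit s"
  then obtain s' a' where "s * s' = 1" "s' * s = 1" "a * a' = 1" "a' * a = 1"
    using assms unfolding two_sided_unit_def by blast
  then show "invertible ?A"
    unfolding invertible_def
    by (intro exI[of _ "vector [vector [0, a'], vector [s', 0]]"])
      (simp add: matrix_mult_2 mat_1_eq_vector smult_vector_2 add_vector_2)
qed

text \<open>The criterion is the invertibility of a Schur complement.\<close>

lemma invertible_rows_iff:
  fixes v w :: "'a::ring_1 ^ 2"
  assumes vw: "invertible (vector [v, w] :: 'a ^ 2 ^ 2)"
    and a: "a * a' = 1" "a' * a = 1"
  shows "invertible (vector [c *s v + d *s w, a *s v + b *s w] :: 'a ^ 2 ^ 2) \<longleftrightarrow>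
    two_sided_unit (d - c * a' * b)"
proof -
  let ?s = "d - c * a' * b"
  let ?L = "vector [vector [1, c * a'], vector [0, 1]] :: 'a ^ 2 ^ 2"
  let ?S = "vector [vector [0, ?s], vector [a, 0]] :: 'a ^ 2 ^ 2"
  let ?U = "vector [vector [1, a' * b], vector [0, 1]] :: 'a ^ 2 ^ 2"
  \<comment> \<open>Gaussian elimination with the unit \<open>a\<close> as pivot: \<open>?L\<close>
    accounts for \<open>c\<close>, \<open>?U\<close> for \<open>b\<close>, and the antidiagonal
    \<open>?S\<close> remains.\<close>
  have "a * (a' * b) = b" "c * a' * a = c"
    using a by (metis mult.assoc mult_1_left, metis mult.assoc mult_1_right)
  then have "vector [vector [c, d], vector [a, b]] = ?L ** (?S ** ?U)"
    by (simp add: matrix_mult_2 smult_vector_2 add_vector_2)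
  then have "vector [c *s v + d *s w, a *s v + b *s w] = ?L ** (?S ** ?U) ** vector [v, w]"
    by (metis matrix_mult_2)
  moreover have "two_sided_unit a"
    using a unfolding two_sided_unit_def by blast
  ultimately show ?thesis
    by (simp add: invertible_matrix_mult_left_iff invertible_matrix_mult_right_iff
        invertible_upper_unitriangular invertible_antidiagonal_iff vw)
qed

text \<open>Completes an admissible vector to a basis, so that coordinates adapted to a point
  replace moving that point to \<open>R(1,0)\<close>.\<close>

lemma admissible_iff_basis:
  fixes v :: "'a::ring_1 ^ 2"
  shows "admissible v \<longleftrightarrow> (\<exists>w. invertible (vector [v, w] :: 'a ^ 2 ^ 2))"
proof
  assume "admissible v"
  then obtain A :: "'a ^ 2 ^ 2" where A: "invertible A" "row 1 A = v"
    unfolding admissible_def by blast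
  then have "A = vector [v, row 2 A]"
    by (auto simp: vec_eq_iff forall_2 row_def)
  with A(1) show "\<exists>w. invertible (vector [v, w] :: 'a ^ 2 ^ 2)"
    by metis
next
  assume "\<exists>w. invertible (vector [v, w] :: 'a ^ 2 ^ 2)"
  then obtain w where "invertible (vector [v, w] :: 'a ^ 2 ^ 2)" ..
  moreover have "row 1 (vector [v, w] :: 'a ^ 2 ^ 2) = v"
    by (simp add: vec_eq_iff row_def)
  ultimately show "admissible v"
    unfolding admissible_def by blast
qed

lemma basis_coordinates:
  fixes v w u :: "'a::ring_1 ^ 2"
  assumes "invertible (vector [v, w] :: 'a ^ 2 ^ 2)"
  obtains a b where "u = a *s v + b *s w"
proof -
  obtain B :: "'a ^ 2 ^ 2" where B: "B ** vector [v, w] = (mat 1 :: 'a ^ 2 ^ 2)"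
    using assms unfolding invertible_def by blast
  \<comment> \<open>The zero row pads \<open>u\<close> to a square matrix; the first row of
    \<open>?C\<close> is \<open>u\<close> times the inverse of the basis matrix, hence its
    coordinate row.\<close>
  let ?C = "(vector [u, 0] :: 'a ^ 2 ^ 2) ** B"
  have "?C ** vector [v, w] = (vector [u, 0] :: 'a ^ 2 ^ 2)"
    by (metis B matrix_mul_assoc matrix_mul_rid)
  moreover have "(?C ** vector [v, w]) $ 1 = ?C $ 1 $ 1 *s v + ?C $ 1 $ 2 *s w"
    by (simp add: vec_eq_iff matrix_matrix_mult_def sum_2 distrib_right)
  ultimately show ?thesis
    using that by (metis vector_2(1))
qed

lemma radical_parallelism_sym:
  fixes p q :: "('a::ring_1 ^ 2) set"
  assumes pq: "(p, q) \<in> radical_parallelism"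
  shows "(q, p) \<in> radical_parallelism"
proof -
  have P: "p \<in> projective_line" and Q: "q \<in> projective_line"
    and par: "\<And>x. x \<in> projective_line \<Longrightarrow> distant x p \<Longrightarrow> distant x q"
    using pq unfolding radical_parallelism_def by auto
  obtain v where v: "admissible v" "p = cyclic_submodule v"
    using P unfolding projective_line_def by blast
  obtain u where u: "admissible u" "q = cyclic_submodule u"
    using Q unfolding projective_line_def by blast
  obtain w where vw: "invertible (vector [v, w] :: 'a ^ 2 ^ 2)"
    using v(1) admissible_iff_basis by blast
  obtain a b where u_eq: "u = a *s v + b *s w"
    using basis_coordinates[OF vw] .
  have wv: "invertible (vector [w, v] :: 'a ^ 2 ^ 2)"
    using vw invertible_vector_swap by blast
  have unit: "two_sided_unit (a - b * x)" for x
  proof -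
    let ?y = "x *s v + 1 *s w"
    \<comment> \<open>With \<open>v\<close> written as \<open>1 *s v + 0 *s w\<close>, the Schur
      complement is 1.\<close>
    have yv: "invertible (vector [?y, v] :: 'a ^ 2 ^ 2)"
      using invertible_rows_iff[OF vw, of 1 1 x 1 0] by (simp add: two_sided_unit_def)
    then have y: "admissible ?y"
      using admissible_iff_basis by blast
    then have "cyclic_submodule ?y \<in> projective_line"
      unfolding projective_line_def by blast
    moreover have "distant (cyclic_submodule ?y) p"
      using yv v y distant_cyclic_submodule_iff by blast
    ultimately have "distant (cyclic_submodule ?y) q"
      by (rule par)
    then have "invertible (vector [u, ?y] :: 'a ^ 2 ^ 2)"
      using u y distant_cyclic_submodule_iff invertible_vector_swap by blast
    \<comment> \<open>In the reversed basis \<open>w\<close>, \<open>v\<close> the pivot is the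
      coefficient 1 of \<open>w\<close> in \<open>?y\<close>, and the Schur complement becomes
      \<open>a - b * x\<close>.\<close>
    then have "invertible (vector [b *s w + a *s v, 1 *s w + x *s v] :: 'a ^ 2 ^ 2)"
      by (simp add: u_eq add.commute)
    then show ?thesis
      using invertible_rows_iff[OF wv, of 1 1 b a x] by simp
  qed
  \<comment> \<open>The case \<open>x = 0\<close> makes \<open>a\<close> a unit. Thus
    \<open>q\<close> is also spanned by \<open>v + (a' * b) *s w\<close>, and \<open>a' * b\<close>
    is the element \<open>j\<close> of the overview.\<close>
  obtain a' where a': "a * a' = 1" "a' * a = 1"
    using unit[of 0] unfolding two_sided_unit_def by auto
  have unit_a': "two_sided_unit a'"
    using a' unfolding two_sided_unit_def by blast
  have unit_one_plus: "two_sided_unit (1 + (a' * b) * x)" for x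
    using two_sided_unit_mult[OF unit_a' unit[of "- x"]] a' by (simp add: algebra_simps)
  have "distant y p" if "y \<in> projective_line" and "distant y q" for y
  proof -
    obtain z where z: "admissible z" "y = cyclic_submodule z"
      using \<open>y \<in> projective_line\<close> unfolding projective_line_def by blast
    obtain c d where z_eq: "z = c *s v + d *s w"
      using basis_coordinates[OF vw] .
    have "invertible (vector [z, u] :: 'a ^ 2 ^ 2)"
      using \<open>distant y q\<close> z u distant_cyclic_submodule_iff by blast
    \<comment> \<open>Now \<open>a\<close> serves as the pivot, and \<open>?s\<close> is
      \<open>d - c * j\<close>.\<close>
    then have s: "two_sided_unit (d - c * a' * b)" (is "two_sided_unit ?s")
      using invertible_rows_iff[OF vw a'] unfolding z_eq u_eq by blast
    then obtain s' where s': "?s * s' = 1"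
      unfolding two_sided_unit_def by blast
    \<comment> \<open>The choice \<open>x = s' * c\<close> is made so that, after the factors are
      exchanged, multiplication by \<open>?s\<close> gives \<open>?s + c * j = d\<close>; hence
      \<open>d\<close> is a product of units.\<close>
    have "two_sided_unit (1 + (s' * c) * (a' * b))"
      using unit_one_plus by (rule two_sided_unit_one_plus_mult_commute)
    then have "two_sided_unit (?s * (1 + (s' * c) * (a' * b)))"
      by (rule two_sided_unit_mult[OF s])
    moreover have "?s * (1 + (s' * c) * (a' * b)) = ?s + (?s * s') * (c * (a' * b))"
      by (simp only: distrib_left mult_1_right mult.assoc)
    then have "?s * (1 + (s' * c) * (a' * b)) = d"
      unfolding s' by (simp add: mult.assoc)
    \<comment> \<open>Against the row \<open>v\<close>, with coordinates 1 and 0, the Schur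
      complement is \<open>d\<close> itself.\<close>
    ultimately have "invertible (vector [z, v] :: 'a ^ 2 ^ 2)"
      using invertible_rows_iff[OF vw, of 1 1 c d 0] by (simp add: z_eq)
    then show ?thesis
      using z v distant_cyclic_submodule_iff by blast
  qed
  then show ?thesis
    using P Q unfolding radical_parallelism_def by blast
qed

theorem corollary2p3:
  shows "equiv (projective_line :: ('a::ring_1 ^ 2) set set) radical_parallelism"
proof (rule equivI)
  show "radical_parallelism \<subseteq> projective_line \<times> (projective_line :: ('a ^ 2) set set)"
    unfolding radical_parallelism_def by blast
  show "refl_on (projective_line :: ('a ^ 2) set set) radical_parallelism"
    unfolding refl_on_def radical_parallelism_def by blast
  show "sym (radical_parallelism :: (('a ^ 2) set \<times> ('a ^ 2) set) set)"
    by (rule symI) (rule radical_parallelism_sym)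
  show "trans (radical_parallelism :: (('a ^ 2) set \<times> ('a ^ 2) set) set)"
    unfolding trans_def radical_parallelism_def by blast
qed

end
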